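(* Let $p$ be a prime, let $d\neq0$ be a rational number and let $x$ be a $p$-adic integer. (i) For every positive integer $n$, \[ \sum_{k=0}^{n-1}\left(x^2+x-(1+4d)k^2-(1-2d)k\right)\frac{d^{-k}{x\choose k}{x+k\choose k}}{{2k\choose k}} =-2nd+n\sum_{k=0}^{n-1}\left(x^2+x+2d-(1+4d)k^2-(1+2d)k\right)\frac{d^{-k}{x\choose k}{x+k\choose k}}{(k+1){2k\choose k}} \] \[ =(2n-1)\sum_{k=0}^{n-1}\left(x^2+x-(1+4d)k^2-(1+2d)k\right)\frac{d^{-k}{x\choose k}{x+k\choose k}}{(2k+1){2k\choose k}}. \] (ii) For every positive odd integer $n$, \[ \sum_{k=0}^{\frac{n-1}{2}}\left(x^2+x-(1+4d)k^2-(1-2d)k\right)\frac{d^{-k}{x\choose k}{x+k\choose k}}{{2k\choose k}} =-d(n+1)+\frac{n+1}{2}\sum_{k=0}^{\frac{n-1}{2}}\left(x^2+x+2d-(1+4d)k^2-(1+2d)k\right)\frac{d^{-k}{x\choose k}{x+k\choose k}}{(k+1){2k\choose k}} \] \[ =n\sum_{k=0}^{\frac{n-1}{2}}\left(x^2+x-(1+4d)k^2-(1+2d)k\right)\frac{d^{-k}{x\choose k}{x+k\choose k}}{(2k+1){2k\choose k}}. \]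
   Context: For $x\in\mathbb{Z}_p$ and $k\in\{0,1,2,\dots\}$, ${x\choose k}=\frac{x(x-1)\cdots(x-k+1)}{k!}$ is the generalized binomial coefficient. The identities are equalities in $\mathbb{Q}_p$. *)

theory Defs
  imports
    "HOL-Computational_Algebra.Computational_Algebra"
    "HOL-Number_Theory.Cong"
    "Berlekamp_Zassenhaus.Finite_Field"
begin

text \<open>The prime \<open>p\<close> is the cardinality of the index type \<open>'p\<close> of class \<open>prime_card\<close>.  The
  \<open>p\<close>-adic integers are the inverse limit of the rings \<open>\<int>/p^n\<int>\<close>: coherent sequences whose \<open>n\<close>-th
  entry is the canonical representative of a residue class modulo \<open>p^n\<close>.\<close>

typedef (overloaded) ('p::prime_card) padic_int =
  "{f :: nat \<Rightarrow> int. \<forall>n. f n \<in> {0..<int CARD('p) ^ n} \<and> f (Suc n) mod int CARD('p) ^ n = f n}"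
  by (rule exI[of _ "\<lambda>_. 0"]) simp

setup_lifting type_definition_padic_int

lemma coherent_mod_aux:
  fixes a b P :: int
  assumes "P > 0" "b mod P ^ n = a mod P ^ n"
  shows "a mod P ^ n \<in> {0..<P ^ n} \<and> (b mod P ^ Suc n) mod P ^ n = a mod P ^ n"
  using assms by (simp add: mod_mod_cancel)

lemma card_pos_int: "int CARD('p::prime_card) > 0"
  by simp

instantiation padic_int :: (prime_card) comm_ring_1
begin

lift_definition zero_padic_int :: "'a padic_int" is "\<lambda>_. 0"
  by simp

lift_definition one_padic_int :: "'a padic_int" is "\<lambda>n. 1 mod int CARD('a) ^ n"
  by (intro allI coherent_mod_aux card_pos_int) simp

lift_definition plus_padic_int :: "'a padic_int \<Rightarrow> 'a padic_int \<Rightarrow> 'a padic_int"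
  is "\<lambda>f g n. (f n + g n) mod int CARD('a) ^ n"
  by (intro allI coherent_mod_aux card_pos_int) (metis mod_add_eq mod_mod_trivial)

lift_definition uminus_padic_int :: "'a padic_int \<Rightarrow> 'a padic_int"
  is "\<lambda>f n. (- f n) mod int CARD('a) ^ n"
  by (intro allI coherent_mod_aux card_pos_int) (metis mod_minus_eq)

lift_definition minus_padic_int :: "'a padic_int \<Rightarrow> 'a padic_int \<Rightarrow> 'a padic_int"
  is "\<lambda>f g n. (f n - g n) mod int CARD('a) ^ n"
  by (intro allI coherent_mod_aux card_pos_int) (metis mod_diff_eq)

lift_definition times_padic_int :: "'a padic_int \<Rightarrow> 'a padic_int \<Rightarrow> 'a padic_int"
  is "\<lambda>f g n. (f n * g n) mod int CARD('a) ^ n"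
  by (intro allI coherent_mod_aux card_pos_int) (metis mod_mult_eq)

instance
proof
  fix a b c :: "'a padic_int"
  show "a * b * c = a * (b * c)"
    by transfer (simp add: mod_mult_left_eq mod_mult_right_eq mult.assoc)
  show "a * b = b * a"
    by transfer (simp add: mult.commute)
  show "1 * a = a"
    by transfer (auto simp: mod_mult_left_eq)
  show "a + b + c = a + (b + c)"
    by transfer (simp add: mod_add_left_eq mod_add_right_eq add.assoc)
  show "a + b = b + a"
    by transfer (simp add: add.commute)
  show "0 + a = a"
    by transfer auto
  show "- a + a = 0"
    by transfer (simp add: mod_add_left_eq)
  show "a - b = a + - b"
    by transfer (simp add: mod_add_right_eq)
  show "(a + b) * c = a * c + b * c"
    by transfer (simp add: mod_mult_left_eq mod_add_eq distrib_right)
  show "(0 :: 'a padic_int) \<noteq> 1"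
  proof transfer
    have "1 mod int CARD('a) ^ 1 = 1"
      using prime_gt_1_nat[OF prime_card[where ?'a = 'a]] by simp
    then show "(\<lambda>_. 0) \<noteq> (\<lambda>n. 1 mod int CARD('a) ^ n)"
      by (metis zero_neq_one)
  qed
qed

end

lemma padic_coherent:
  fixes f :: "nat \<Rightarrow> int" and P :: int
  assumes "\<forall>n. f n \<in> {0..<P ^ n} \<and> f (Suc n) mod P ^ n = f n"
  shows "f (n + k) mod P ^ n = f n"
proof (induction k)
  case 0
  then show ?case using assms by auto
next
  case (Suc k)
  have "f (n + Suc k) mod P ^ n = (f (Suc (n + k)) mod P ^ (n + k)) mod P ^ n"
    by (simp add: mod_mod_cancel le_imp_power_dvd)
  also have "\<dots> = f n"
    using assms Suc.IH by simp
  finally show ?case .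
qed

instance padic_int :: (prime_card) idom
proof
  fix a b :: "'a padic_int"
  assume "a \<noteq> 0" "b \<noteq> 0"
  then show "a * b \<noteq> 0"
  proof transfer
    fix f g :: "nat \<Rightarrow> int"
    let ?P = "int CARD('a)"
    assume f: "\<forall>n. f n \<in> {0..<?P ^ n} \<and> f (Suc n) mod ?P ^ n = f n"
      and g: "\<forall>n. g n \<in> {0..<?P ^ n} \<and> g (Suc n) mod ?P ^ n = g n"
      and "f \<noteq> (\<lambda>_. 0)" "g \<noteq> (\<lambda>_. 0)"
    then obtain i j where ij: "f i \<noteq> 0" "g j \<noteq> 0" by (metis ext)
    have pr: "prime ?P" using prime_card[where ?'a = 'a] by simp
    let ?a = "f (i + j)" and ?b = "g (j + i)"
    have a: "\<not> ?P ^ i dvd ?a" using padic_coherent[OF f, of i j] ij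
      by (simp add: dvd_eq_mod_eq_0)
    have b: "\<not> ?P ^ j dvd ?b" using padic_coherent[OF g, of j i] ij
      by (simp add: dvd_eq_mod_eq_0)
    have nz: "?a \<noteq> 0" "?b \<noteq> 0" using a b by auto
    have "multiplicity ?P ?a < i" "multiplicity ?P ?b < j"
      using a b by (meson multiplicity_dvd' not_le)+
    then have "multiplicity ?P (?a * ?b) < i + j"
      using pr nz by (simp add: prime_elem_multiplicity_mult_distrib)
    then have "\<not> ?P ^ (i + j) dvd ?a * ?b"
      using pr nz by (metis mult_eq_0_iff multiplicity_geI not_le not_prime_unit)
    then have "(?a * ?b) mod ?P ^ (i + j) \<noteq> 0"
      by (simp add: dvd_eq_mod_eq_0)
    then show "(\<lambda>n. (f n * g n) mod ?P ^ n) \<noteq> (\<lambda>_. 0)"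
      by (metis add.commute)
  qed
qed

lemma Rep_padic_int_of_nat:
  "Rep_padic_int (of_nat m :: 'p::prime_card padic_int) n = int m mod int CARD('p) ^ n"
  by (induction m)
     (simp_all add: zero_padic_int.rep_eq one_padic_int.rep_eq plus_padic_int.rep_eq mod_add_eq)

instance padic_int :: (prime_card) ring_char_0
proof
  have "m = m'" if eq: "(of_nat m :: 'a padic_int) = of_nat m'" for m m' :: nat
  proof -
    let ?P = "CARD('a)"
    have P: "?P > 1" using prime_gt_1_nat[OF prime_card[where ?'a = 'a]] .
    obtain n where n: "max m m' < ?P ^ n"
      using real_arch_pow[of "real ?P" "real (max m m')"] P
      by (metis of_nat_1 of_nat_less_iff of_nat_power)
    have "int m mod int ?P ^ n = int m' mod int ?P ^ n"
      using eq by (metis Rep_padic_int_of_nat)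
    then have "m mod ?P ^ n = m' mod ?P ^ n"
      by (metis of_nat_eq_iff of_nat_mod of_nat_power)
    then show ?thesis using n by simp
  qed
  then show "inj (of_nat :: nat \<Rightarrow> 'a padic_int)" by (rule injI)
qed

instance fract :: ("{idom, ring_char_0}") field_char_0
proof
  show "inj (of_nat :: nat \<Rightarrow> 'a fract)"
    by (rule injI) (simp add: of_nat_fract eq_fract)
qed

type_synonym 'p padic = "'p padic_int fract"

definition padic_integers :: "'p::prime_card padic set"
  where "padic_integers = range to_fract"

end

theory Submission
  imports Defs
begin

text \<open>Put \<open>t k = d\<^sup>-\<^sup>k (x choose k) (x + k choose k) / (2k choose k)\<close>.  Since
  \<open>(x - k) (x + k + 1) t k = 2 d (k + 1) (2k + 1) t (k + 1)\<close>, the three summands are the forward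
  differences of \<open>2 d k (2k - 1) t k\<close>, \<open>2 d (2k - 1) t k\<close> and \<open>2 d k t k\<close>.  Hence all three
  expressions in (i) equal \<open>2 d n (2n - 1) t n\<close>; part (ii) is (i) at \<open>(n + 1) / 2\<close>.\<close>

text \<open>Absorption is applied twice, with the symmetry (2k+1 choose k) = (2k+1 choose k+1) in
  between.\<close>

lemma central_binomial_Suc:
  "Suc k * ((2 * Suc k) choose Suc k) = 2 * (2 * k + 1) * ((2 * k) choose k)"
proof -
  have "Suc k * ((2 * Suc k) choose Suc k) = 2 * (Suc k * (Suc (2 * k) choose k))"
    using Suc_times_binomial[of k "Suc (2 * k)"] by simp
  also have "Suc k * (Suc (2 * k) choose k) = (2 * k + 1) * ((2 * k) choose k)"
    using Suc_times_binomial[of k "2 * k"] binomial_symmetric[of k "Suc (2 * k)"] by simp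
  finally show ?thesis by simp
qed

text \<open>The factors k + 1 and 2k + 1 of the other denominators are left out, so that all three
  sums share this one term.\<close>

definition central_gbinomial_term :: "'a::field_char_0 \<Rightarrow> 'a \<Rightarrow> nat \<Rightarrow> 'a"
  where "central_gbinomial_term d x k =
    d powi (- int k) * (x gchoose k) * ((x + of_nat k) gchoose k) / of_nat ((2 * k) choose k)"

lemma central_gbinomial_term_0 [simp]: "central_gbinomial_term d x 0 = 1"
  by (simp add: central_gbinomial_term_def)

text \<open>From k to k + 1 the factors of the term gain 1/d, (x - k)/(k + 1), (x + k + 1)/(k + 1)
  and, in the denominator, 2 (2k + 1)/(k + 1). The form without quotients also covers x = k, where
  both sides vanish.\<close>

lemma central_gbinomial_term_Suc:
  assumes "d \<noteq> 0"
  shows "(x - of_nat k) * (x + of_nat k + 1) * central_gbinomial_term d x k =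
    2 * d * (of_nat k + 1) * (2 * of_nat k + 1) * central_gbinomial_term d x (Suc k)"
proof -
  define K :: 'a where "K = of_nat k"
  define a a' where "a = x gchoose k" and "a' = x gchoose Suc k"
  define b b' where "b = (x + K) gchoose k" and "b' = (x + of_nat (Suc k)) gchoose Suc k"
  define c c' :: 'a where "c = of_nat ((2 * k) choose k)"
    and "c' = of_nat ((2 * Suc k) choose Suc k)"
  define e e' where "e = d powi (- int k)" and "e' = d powi (- int (Suc k))"
  have K1: "K + 1 \<noteq> 0" and K2: "2 * K + 1 \<noteq> 0"
    using of_nat_neq_0[of k, where 'a = 'a] of_nat_neq_0[of "2 * k", where 'a = 'a]
    by (simp_all add: K_def add.commute)
  \<comment> \<open>This is the factor 2 (2K + 1) of \<open>c'\<close> multiplied out, a denominator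
    in the final simplification.\<close>
  have K3: "4 * K + 2 \<noteq> 0"
  proof -
    have "4 * K + 2 = 2 * (2 * K + 1)" by simp
    with K2 show ?thesis by (metis mult_eq_0_iff zero_neq_numeral)
  qed
  have c: "c \<noteq> 0" "c' \<noteq> 0"
    by (simp_all add: c_def c'_def del: mult_Suc_right)
  have "(K + 1) * c' = 2 * (2 * K + 1) * c"
    using arg_cong[OF central_binomial_Suc[of k], of "of_nat :: nat \<Rightarrow> 'a"]
    by (simp add: K_def c_def c'_def algebra_simps del: mult_Suc_right binomial_Suc_Suc)
  then have c': "c' = 2 * (2 * K + 1) * c / (K + 1)"
    using K1 by (simp add: field_simps)
  have "(x - K) * a = (K + 1) * a'"
    using gbinomial_mult_1[of x k] by (simp add: K_def a_def a'_def algebra_simps)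
  then have a': "a' = (x - K) * a / (K + 1)"
    using K1 by (simp add: field_simps)
  have b': "b' = b * ((x + K + 1) / (K + 1))"
    using gbinomial_rec[of "x + K" k] by (simp add: K_def b_def b'_def add_ac)
  have e': "e' = e / d"
    using assms by (simp add: e_def e'_def power_int_minus power_int_add field_simps del: of_nat_Suc)
  have "(x - K) * (x + K + 1) * (e * a * b / c) =
      2 * d * (K + 1) * (2 * K + 1) * (e' * a' * b' / c')"
    unfolding a' b' c' e' using K1 K2 K3 c assms by (simp add: divide_simps)
  then show ?thesis
    unfolding central_gbinomial_term_def K_def a_def a'_def b_def b'_def c_def c'_def e_def e'_def .
qed

context
  fixes d x :: "'a::field_char_0"
  assumes d: "d \<noteq> 0"
begin

text \<open>The weight at n is (x - n) (x + n + 1) - 2 d n (2n - 1); the recurrence turns its first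
  product into the closed form at n + 1.\<close>

lemma sum_central_gbinomial:
  "(\<Sum>k<n. (x^2 + x - (1 + 4*d) * of_nat k ^ 2 - (1 - 2*d) * of_nat k) *
      central_gbinomial_term d x k)
    = 2 * d * of_nat n * (2 * of_nat n - 1) * central_gbinomial_term d x n"
proof (induction n)
  case (Suc n)
  have step: "(x^2 + x - (1 + 4*d) * of_nat n ^ 2 - (1 - 2*d) * of_nat n) *
      central_gbinomial_term d x n
    = 2 * d * (of_nat n + 1) * (2 * of_nat n + 1) * central_gbinomial_term d x (Suc n)
      - 2 * d * of_nat n * (2 * of_nat n - 1) * central_gbinomial_term d x n"
    unfolding central_gbinomial_term_Suc[OF d, of x n, symmetric]
    by (simp add: algebra_simps power2_eq_square)
  show ?case unfolding sum.lessThan_Suc Suc.IH step by (simp add: algebra_simps)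
qed simp

text \<open>Here the weight is (x - n) (x + n + 1) - 2 d (2n - 1) (n + 1). The telescoped function
  is -2 d at 0, whence the constant 2 d and, after multiplication by n, the term -2 n d of the
  theorem.\<close>

lemma sum_central_gbinomial_div_Suc:
  "(\<Sum>k<n. (x^2 + x + 2*d - (1 + 4*d) * of_nat k ^ 2 - (1 + 2*d) * of_nat k) *
      (central_gbinomial_term d x k / (of_nat k + 1)))
    = 2 * d + 2 * d * (2 * of_nat n - 1) * central_gbinomial_term d x n"
proof (induction n)
  case (Suc n)
  have nz: "of_nat n + 1 \<noteq> (0 :: 'a)"
    using of_nat_neq_0[of n, where 'a = 'a] by (simp add: add.commute)
  have step: "(x^2 + x + 2*d - (1 + 4*d) * of_nat n ^ 2 - (1 + 2*d) * of_nat n) *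
      (central_gbinomial_term d x n / (of_nat n + 1))
    = 2 * d * (2 * of_nat n + 1) * central_gbinomial_term d x (Suc n)
      - 2 * d * (2 * of_nat n - 1) * central_gbinomial_term d x n"
    unfolding times_divide_eq_right nonzero_divide_eq_eq[OF nz]
    using central_gbinomial_term_Suc[OF d, of x n]
    by (simp add: algebra_simps power2_eq_square)
  show ?case unfolding sum.lessThan_Suc Suc.IH step by (simp add: algebra_simps)
qed simp

text \<open>Here the weight is (x - n) (x + n + 1) - 2 d n (2n + 1), so 2n + 1 cancels after the
  recurrence.\<close>

lemma sum_central_gbinomial_div_odd:
  "(\<Sum>k<n. (x^2 + x - (1 + 4*d) * of_nat k ^ 2 - (1 + 2*d) * of_nat k) *
      (central_gbinomial_term d x k / (2 * of_nat k + 1)))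
    = 2 * d * of_nat n * central_gbinomial_term d x n"
proof (induction n)
  case (Suc n)
  have nz: "2 * of_nat n + 1 \<noteq> (0 :: 'a)"
    using of_nat_neq_0[of "2 * n", where 'a = 'a] by (simp add: add.commute)
  have step: "(x^2 + x - (1 + 4*d) * of_nat n ^ 2 - (1 + 2*d) * of_nat n) *
      (central_gbinomial_term d x n / (2 * of_nat n + 1))
    = 2 * d * (of_nat n + 1) * central_gbinomial_term d x (Suc n)
      - 2 * d * of_nat n * central_gbinomial_term d x n"
    unfolding times_divide_eq_right nonzero_divide_eq_eq[OF nz]
    using central_gbinomial_term_Suc[OF d, of x n]
    by (simp add: algebra_simps power2_eq_square)
  show ?case unfolding sum.lessThan_Suc Suc.IH step by (simp add: algebra_simps)
qed simp

end

theorem theorem1p5: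
  fixes d x :: "'p::prime_card padic"
  assumes "d \<in> \<rat>" and "d \<noteq> 0" and "x \<in> padic_integers"
  shows
    "(\<forall>n::nat. n > 0 \<longrightarrow>
        (\<Sum>k<n. (x^2 + x - (1 + 4*d) * of_nat k ^ 2 - (1 - 2*d) * of_nat k) *
            (d powi (- int k) * (x gchoose k) * ((x + of_nat k) gchoose k)
              / of_nat ((2*k) choose k)))
          = - 2 * of_nat n * d + of_nat n *
            (\<Sum>k<n. (x^2 + x + 2*d - (1 + 4*d) * of_nat k ^ 2 - (1 + 2*d) * of_nat k) *
              (d powi (- int k) * (x gchoose k) * ((x + of_nat k) gchoose k)
                / ((of_nat k + 1) * of_nat ((2*k) choose k))))
      \<and> - 2 * of_nat n * d + of_nat n *
            (\<Sum>k<n. (x^2 + x + 2*d - (1 + 4*d) * of_nat k ^ 2 - (1 + 2*d) * of_nat k) *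
              (d powi (- int k) * (x gchoose k) * ((x + of_nat k) gchoose k)
                / ((of_nat k + 1) * of_nat ((2*k) choose k))))
          = (2 * of_nat n - 1) *
            (\<Sum>k<n. (x^2 + x - (1 + 4*d) * of_nat k ^ 2 - (1 + 2*d) * of_nat k) *
              (d powi (- int k) * (x gchoose k) * ((x + of_nat k) gchoose k)
                / ((2 * of_nat k + 1) * of_nat ((2*k) choose k)))))
   \<and> (\<forall>n::nat. n > 0 \<and> odd n \<longrightarrow>
        (\<Sum>k\<le>(n - 1) div 2. (x^2 + x - (1 + 4*d) * of_nat k ^ 2 - (1 - 2*d) * of_nat k) *
            (d powi (- int k) * (x gchoose k) * ((x + of_nat k) gchoose k)
              / of_nat ((2*k) choose k)))
          = - d * (of_nat n + 1) + (of_nat n + 1) / 2 *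
            (\<Sum>k\<le>(n - 1) div 2. (x^2 + x + 2*d - (1 + 4*d) * of_nat k ^ 2 - (1 + 2*d) * of_nat k) *
              (d powi (- int k) * (x gchoose k) * ((x + of_nat k) gchoose k)
                / ((of_nat k + 1) * of_nat ((2*k) choose k))))
      \<and> - d * (of_nat n + 1) + (of_nat n + 1) / 2 *
            (\<Sum>k\<le>(n - 1) div 2. (x^2 + x + 2*d - (1 + 4*d) * of_nat k ^ 2 - (1 + 2*d) * of_nat k) *
              (d powi (- int k) * (x gchoose k) * ((x + of_nat k) gchoose k)
                / ((of_nat k + 1) * of_nat ((2*k) choose k))))
          = of_nat n *
            (\<Sum>k\<le>(n - 1) div 2. (x^2 + x - (1 + 4*d) * of_nat k ^ 2 - (1 + 2*d) * of_nat k) *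
              (d powi (- int k) * (x gchoose k) * ((x + of_nat k) gchoose k)
                / ((2 * of_nat k + 1) * of_nat ((2*k) choose k)))))"
proof -
  \<comment> \<open>Detaching k + 1 or 2k + 1 from the denominator lets
    \<open>central_gbinomial_term\<close> be folded.\<close>
  have div_mult: "a / (b * c) = a / c / b" for a b c :: "'p padic"
    by (simp add: mult.commute)
  note sums = sum_central_gbinomial[OF \<open>d \<noteq> 0\<close>, of x]
    sum_central_gbinomial_div_Suc[OF \<open>d \<noteq> 0\<close>, of x]
    sum_central_gbinomial_div_odd[OF \<open>d \<noteq> 0\<close>, of x]
  \<comment> \<open>With m = (n + 1)/2 the closed range has m elements, and the prefactors (n + 1)/2
    and n become m and 2m - 1 as in (i).\<close>
  have half: "\<exists>m. {..(n - 1) div 2} = {..<m} \<and> (of_nat n :: 'p padic) = 2 * of_nat m - 1"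
    if "n > 0 \<and> odd n" for n :: nat
    using that by (intro exI[of _ "Suc ((n - 1) div 2)"]) (auto elim!: oddE)
  show ?thesis
    \<comment> \<open>The oddness premise triggers \<open>half\<close> only in (ii). Once the sums
      are evaluated, every goal is a ring identity in a single value of the term.\<close>
    unfolding div_mult central_gbinomial_term_def[symmetric]
    by (intro conjI allI impI; (drule half, elim exE conjE)?; simp only: sums)
      (simp_all add: algebra_simps)
qed

end
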